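(* Let $(V,E,<)$ be a wellordered connected graph such that $(V,<)$ has limit order type, and let $\prec$ be its algorithmic traversal. Then any $<$-cofinal subset of $V$ is also $\prec$-cofinal.
   Context: A wellordered connected graph $(V,E,<)$ is a (nonempty, possibly infinite) connected undirected graph $(V,E)$ together with a wellordering $<$ of $V$. Deterministic graph search on $(V,E,<)$ defines sets $S_\alpha\subseteq V$ by transfinite recursion: $S_0=\emptyset$; $S_1=\{v_0\}$, where $v_0$ is the $<$-least element of $V$; for $\beta\ge 1$, $S_{\beta+1}$ is obtained from $S_\beta$ by adding the $<$-least element of $\{v\in V\setminus S_\beta:\exists w\in S_\beta\ E(w,v)\}$ if this set is nonempty, and $S_{\beta+1}=S_\beta$ otherwise; and $S_\alpha=\bigcup_{\beta<\alpha}S_\beta$ at limit $\alpha$. Every vertex eventually enters some $S_\alpha$. The algorithmic traversal is the wellordering $\prec$ of $V$ given by $v\prec w$ iff the least $\alpha$ with $v\in S_\alpha$ is less than the least $\alpha$ with $w\in S_\alpha$. *)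

theory Defs
  imports "HOL-Algebra.Free_Abelian_Groups"
begin

text \<open>
  The recursion combinator \<open>worecZSL\<close> and the predicate \<open>isLimOrd\<close> come from the theory
  \<open>Wellorder_Constructions\<close> of HOL-Cardinals, which the import brings in transitively.
  Following that library, the wellordering of the vertices is a reflexive relation \<open>r\<close> with
  \<open>Field r = V\<close>. Loops are not excluded; they have no influence on the search.
\<close>

locale wellordered_connected_graph =
  fixes V :: "'v set" and E :: "'v rel" and r :: "'v rel"
  assumes nonempty: "V \<noteq> {}"
    and edges: "E \<subseteq> V \<times> V"
    and undirected: "sym E"
    and connected: "\<And>v w. v \<in> V \<Longrightarrow> w \<in> V \<Longrightarrow> (v, w) \<in> E\<^sup>*"
    and wellordered: "well_order_on V r"

definition frontier :: "'v set \<Rightarrow> 'v rel \<Rightarrow> 'v set \<Rightarrow> 'v set" where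
  "frontier V E S = {v \<in> V - S. \<exists>w\<in>S. (w, v) \<in> E}"

definition search_step :: "'v set \<Rightarrow> 'v rel \<Rightarrow> 'v rel \<Rightarrow> 'v set \<Rightarrow> 'v set" where
  "search_step V E r S =
     (if frontier V E S = {} then S else insert (wo_rel.minim r (frontier V E S)) S)"

text \<open>
  The sets \<open>S\<^sub>\<alpha>\<close>, with the elements of the field of a wellorder \<open>k\<close> in the role of the
  ordinals \<open>\<alpha>\<close>.
\<close>

definition search_stage ::
    "'i rel \<Rightarrow> 'v set \<Rightarrow> 'v rel \<Rightarrow> 'v rel \<Rightarrow> 'i \<Rightarrow> 'v set" where
  "search_stage k V E r =
     wo_rel.worecZSL k
       {}
       (\<lambda>\<beta> S. if \<beta> = wo_rel.zero k then {wo_rel.minim r V} else search_step V E r S)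
       (\<lambda>S \<alpha>. \<Union>\<beta>\<in>underS k \<alpha>. S \<beta>)"

text \<open>
  HOL has no type of all ordinals. The ordinals below the successor cardinal of \<open>|V|\<close> are
  enough: every vertex enters at such a stage (lemma \<open>all_vertices_enter\<close> below), so later
  stages would all equal \<open>V\<close>.
\<close>

abbreviation ordinals_for :: "'v set \<Rightarrow> 'v set rel" where
  "ordinals_for V \<equiv> cardSuc (card_of V)"

definition entry_stage :: "'v set \<Rightarrow> 'v rel \<Rightarrow> 'v rel \<Rightarrow> 'v \<Rightarrow> 'v set" where
  "entry_stage V E r v =
     wo_rel.minim (ordinals_for V)
       {\<alpha> \<in> Field (ordinals_for V). v \<in> search_stage (ordinals_for V) V E r \<alpha>}"

text \<open>The strict order \<open>\<prec>\<close>.\<close>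

definition traversal :: "'v set \<Rightarrow> 'v rel \<Rightarrow> 'v rel \<Rightarrow> 'v rel" where
  "traversal V E r =
     {(v, w) \<in> V \<times> V.
        (entry_stage V E r v, entry_stage V E r w) \<in> ordinals_for V - Id}"

text \<open>
  The reflexive closure makes this applicable to strict and to reflexive orders alike. The
  library's \<open>cofinal\<close> demands a strictly larger element of \<open>A\<close>, so with it an order with a
  greatest element would have no cofinal subset.
\<close>

definition cofinal_subset :: "'v set \<Rightarrow> 'v rel \<Rightarrow> 'v set \<Rightarrow> bool" where
  "cofinal_subset V R A \<longleftrightarrow> A \<subseteq> V \<and> (\<forall>v\<in>V. \<exists>a\<in>A. (v, a) \<in> R\<^sup>=)"


lemma search_stage_adm:
  assumes "wo_rel k"
  shows "wo_rel.adm_woL k (\<lambda>S \<alpha>. \<Union>\<beta>\<in>underS k \<alpha>. S \<beta>)"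
  unfolding wo_rel.adm_woL_def[OF assms] by auto

lemma search_stage_zero:
  assumes "wo_rel k"
  shows "search_stage k V E r (wo_rel.zero k) = {}"
  unfolding search_stage_def
  by (rule wo_rel.worecZSL_zero[OF assms search_stage_adm[OF assms]])

lemma search_stage_succ:
  assumes "wo_rel k" "aboveS k \<beta> \<noteq> {}"
  shows "search_stage k V E r (wo_rel.succ k \<beta>) =
    (if \<beta> = wo_rel.zero k then {wo_rel.minim r V} else search_step V E r (search_stage k V E r \<beta>))"
  unfolding search_stage_def
  by (rule wo_rel.worecZSL_succ[OF assms(1) search_stage_adm[OF assms(1)] assms(2)])

lemma search_stage_limit:
  assumes "wo_rel k" "wo_rel.isLim k \<alpha>" "\<alpha> \<noteq> wo_rel.zero k"
  shows "search_stage k V E r \<alpha> = (\<Union>\<beta>\<in>underS k \<alpha>. search_stage k V E r \<beta>)"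
  unfolding search_stage_def
  by (rule wo_rel.worecZSL_isLim[OF assms(1) search_stage_adm[OF assms(1)] assms(2,3)])

lemma search_stage_succ_superset:
  assumes "wo_rel k" "aboveS k \<beta> \<noteq> {}"
  shows "search_stage k V E r \<beta> \<subseteq> search_stage k V E r (wo_rel.succ k \<beta>)"
  using search_stage_succ[OF assms, of V E r] search_stage_zero[OF assms(1), of V E r]
  by (auto simp: search_step_def)

lemma search_stage_mono:
  assumes k: "wo_rel k" and "(\<alpha>, \<beta>) \<in> k"
  shows "search_stage k V E r \<alpha> \<subseteq> search_stage k V E r \<beta>"
  using assms(2)
proof (induction \<beta> arbitrary: \<alpha> rule: wo_rel.underS_induct[OF k])
  case (1 \<beta>)
  show ?case
  proof (cases "\<alpha> = \<beta> \<or> \<beta> = wo_rel.zero k")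
    case True
    then show ?thesis using 1(2) wo_rel.leq_zero_imp[OF k] by blast
  next
    case False
    then have \<alpha>: "\<alpha> \<in> underS k \<beta>" using 1(2) by (auto simp: underS_def)
    show ?thesis
    proof (cases "wo_rel.isSucc k \<beta>")
      case True
      then obtain \<gamma> where \<gamma>: "aboveS k \<gamma> \<noteq> {}" "\<beta> = wo_rel.succ k \<gamma>"
        by (auto simp: wo_rel.isSucc_def[OF k])
      have "(\<alpha>, \<gamma>) \<in> k" using \<alpha> wo_rel.underS_succ[OF k \<gamma>(1)] \<gamma>(2) by (auto simp: under_def)
      moreover have "\<gamma> \<in> underS k \<beta>"
        using wo_rel.succ_in_diff[OF k \<gamma>(1)] \<gamma>(2) by (auto simp: underS_def)
      ultimately have "search_stage k V E r \<alpha> \<subseteq> search_stage k V E r \<gamma>" using 1(1) by blast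
      then show ?thesis using search_stage_succ_superset[OF k \<gamma>(1), of V E r] \<gamma>(2) by blast
    next
      case nS: False
      then have "wo_rel.isLim k \<beta>" by (simp add: wo_rel.isLim_def[OF k])
      then have "search_stage k V E r \<beta> = (\<Union>\<gamma>\<in>underS k \<beta>. search_stage k V E r \<gamma>)"
        by (rule search_stage_limit[OF k]) (use False in blast)
      then show ?thesis using \<alpha> by blast
    qed
  qed
qed

context wellordered_connected_graph
begin

lemma r_wo: "wo_rel r" and r_Field: "Field r = V"
  using well_order_on_Well_order[OF wellordered] by (simp_all add: wo_rel_def)

lemma frontier_nonempty:
  assumes "S \<noteq> {}" "S \<subset> V"
  shows "frontier V E S \<noteq> {}"
proof
  assume empty: "frontier V E S = {}"
  from assms obtain s v where sv: "s \<in> S" "v \<in> V" "v \<notin> S" by blast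
  have "(s, v) \<in> E\<^sup>*" using connected sv assms(2) by blast
  then have "v \<in> S"
  proof (induction rule: rtrancl_induct)
    case base
    then show ?case using sv by simp
  next
    case (step y z)
    then show ?case using empty edges by (auto simp: frontier_def)
  qed
  with sv show False by simp
qed

lemma minim_frontier:
  assumes "frontier V E S \<noteq> {}"
  shows "wo_rel.minim r (frontier V E S) \<in> frontier V E S"
  using wo_rel.minim_in[OF r_wo _ assms] r_Field by (auto simp: frontier_def)

lemma least_vertex: "wo_rel.minim r V \<in> V"
  using wo_rel.minim_in[OF r_wo _ nonempty] r_Field by simp

lemma search_stage_subset:
  assumes k: "wo_rel k"
  shows "search_stage k V E r \<alpha> \<subseteq> V"
proof (induction \<alpha> rule: wo_rel.underS_induct[OF k])
  case (1 \<alpha>)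
  show ?case
  proof (cases "wo_rel.isSucc k \<alpha>")
    case True
    then obtain \<gamma> where \<gamma>: "aboveS k \<gamma> \<noteq> {}" "\<alpha> = wo_rel.succ k \<gamma>"
      by (auto simp: wo_rel.isSucc_def[OF k])
    have "\<gamma> \<in> underS k \<alpha>"
      using wo_rel.succ_in_diff[OF k \<gamma>(1)] \<gamma>(2) by (auto simp: underS_def)
    then have "search_stage k V E r \<gamma> \<subseteq> V" using 1 by blast
    then show ?thesis
      using search_stage_succ[OF k \<gamma>(1), of V E r] \<gamma>(2) least_vertex
        minim_frontier[of "search_stage k V E r \<gamma>"]
      by (auto simp: search_step_def frontier_def)
  next
    case False
    then have "wo_rel.isLim k \<alpha>" by (simp add: wo_rel.isLim_def[OF k])
    from search_stage_limit[OF k this, of V E r] search_stage_zero[OF k, of V E r] 1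
    show ?thesis by (cases "\<alpha> = wo_rel.zero k") auto
  qed
qed

lemma search_stage_nonempty:
  assumes k: "wo_rel k" and "\<alpha> \<in> Field k" "\<alpha> \<noteq> wo_rel.zero k"
  shows "search_stage k V E r \<alpha> \<noteq> {}"
proof -
  let ?z = "wo_rel.zero k"
  have z: "(?z, \<alpha>) \<in> k" using wo_rel.zero_smallest[OF k assms(2)] .
  then have a: "aboveS k ?z \<noteq> {}" using assms(3) by (auto simp: aboveS_def)
  have "(wo_rel.succ k ?z, \<alpha>) \<in> k" using wo_rel.succ_smallest[OF k z] assms(3) by blast
  from search_stage_mono[OF k this, of V E r] search_stage_succ[OF k a, of V E r]
  show ?thesis by auto
qed

lemma search_stage_new_vertex:
  assumes k: "wo_rel k" and \<alpha>: "aboveS k \<alpha> \<noteq> {}" and "search_stage k V E r \<alpha> \<subset> V"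
  shows "\<exists>x. x \<in> search_stage k V E r (wo_rel.succ k \<alpha>) - search_stage k V E r \<alpha>"
proof (cases "\<alpha> = wo_rel.zero k")
  case True
  then have "wo_rel.minim r V \<in> search_stage k V E r (wo_rel.succ k \<alpha>)"
    unfolding search_stage_succ[OF k \<alpha>] by simp
  moreover have "search_stage k V E r \<alpha> = {}"
    unfolding True by (rule search_stage_zero[OF k])
  ultimately show ?thesis by blast
next
  case False
  have "\<alpha> \<in> Field k" using \<alpha> unfolding aboveS_def by (blast intro: FieldI1)
  then have "search_stage k V E r \<alpha> \<noteq> {}" using search_stage_nonempty[OF k _ False] by blast
  then have ne: "frontier V E (search_stage k V E r \<alpha>) \<noteq> {}"
    using frontier_nonempty assms(3) by blast
  define x where "x = wo_rel.minim r (frontier V E (search_stage k V E r \<alpha>))"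
  have "x \<in> frontier V E (search_stage k V E r \<alpha>)"
    unfolding x_def by (rule minim_frontier[OF ne])
  then have "x \<notin> search_stage k V E r \<alpha>" by (simp add: frontier_def)
  moreover have "x \<in> search_stage k V E r (wo_rel.succ k \<alpha>)"
    unfolding search_stage_succ[OF k \<alpha>] search_step_def x_def using False ne by simp
  ultimately show ?thesis by blast
qed

lemma all_vertices_enter:
  assumes v: "v \<in> V"
  shows "\<exists>\<alpha>\<in>Field (ordinals_for V). v \<in> search_stage (ordinals_for V) V E r \<alpha>"
proof (rule ccontr)
  let ?k = "ordinals_for V"
  let ?S = "search_stage ?k V E r"
  assume "\<not> ?thesis"
  then have v_out: "v \<notin> ?S \<alpha>" if "\<alpha> \<in> Field ?k" for \<alpha> using that by blast
  have co: "Card_order ?k" by (rule cardSuc_Card_order[OF card_of_Card_order])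
  have k: "wo_rel ?k" unfolding wo_rel_def by (rule card_order_on_well_order_on[OF co])
  define f where "f \<alpha> =
    (if aboveS ?k \<alpha> = {} then v else SOME x. x \<in> ?S (wo_rel.succ ?k \<alpha>) - ?S \<alpha>)" for \<alpha>
  have proper: "?S \<alpha> \<subset> V" if "\<alpha> \<in> Field ?k" for \<alpha>
    using search_stage_subset[OF k] v_out[OF that] v by blast
  have new: "f \<alpha> \<in> ?S (wo_rel.succ ?k \<alpha>) - ?S \<alpha>"
    if "\<alpha> \<in> Field ?k" "aboveS ?k \<alpha> \<noteq> {}" for \<alpha>
    using someI_ex[OF search_stage_new_vertex[OF k that(2) proper[OF that(1)]]] that
    by (simp add: f_def)
  have f_out: "f \<alpha> \<notin> ?S \<alpha>" if "\<alpha> \<in> Field ?k" for \<alpha>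
    using new[OF that] v_out[OF that] by (cases "aboveS ?k \<alpha> = {}") (auto simp: f_def)
  have f_in: "f \<alpha> \<in> V" if "\<alpha> \<in> Field ?k" for \<alpha>
    using new[OF that] v search_stage_subset[OF k]
    by (cases "aboveS ?k \<alpha> = {}") (auto simp: f_def)
  have "inj_on f (Field ?k)"
  proof (rule wo_rel.inj_on_Field[OF k subset_refl])
    fix \<alpha> \<beta> assume \<alpha>\<beta>: "\<alpha> \<in> Field ?k" "\<beta> \<in> Field ?k" "\<alpha> \<in> underS ?k \<beta>"
    then have lt: "(\<alpha>, \<beta>) \<in> ?k" "\<alpha> \<noteq> \<beta>" by (auto simp: underS_def)
    then have "aboveS ?k \<alpha> \<noteq> {}" by (auto simp: aboveS_def)
    then have "f \<alpha> \<in> ?S (wo_rel.succ ?k \<alpha>)" using new \<alpha>\<beta>(1) by blast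
    then have "f \<alpha> \<in> ?S \<beta>"
      using search_stage_mono[OF k wo_rel.succ_smallest[OF k lt], of V E r] by blast
    then show "f \<alpha> \<noteq> f \<beta>" using f_out[OF \<alpha>\<beta>(2)] by metis
  qed
  then have "ordLeq3 (card_of (Field ?k)) (card_of V)"
    using f_in by (intro card_of_ordLeqI[of f])
  moreover have "ordIso2 (card_of (Field ?k)) ?k" using card_of_Field_ordIso[OF co] .
  ultimately have "ordLeq3 ?k (card_of V)"
    using ordIso_symmetric ordIso_ordLeq_trans by blast
  moreover have "ordLess2 (card_of V) ?k" by (rule cardSuc_greater[OF card_of_Card_order])
  ultimately show False by (simp add: not_ordLess_ordLeq)
qed

end

end

theory Submission
  imports Defs
begin

text \<open>
  The reason is that the vertices \<open>\<prec>\<close>-before a given vertex \<open>v\<close> are \<open><\<close>-bounded (lemma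
  \<open>predecessors_bounded\<close>). If \<open>v\<close> is not the root, it was found along an edge from some \<open>s \<prec> v\<close>
  (lemma \<open>earlier_neighbour\<close>). From the entry of \<open>s\<close> onwards \<open>v\<close> is a candidate, so whatever
  enters between \<open>s\<close> and \<open>v\<close> was preferred to \<open>v\<close> and hence is \<open><\<close>-below \<open>v\<close> (lemma
  \<open>between_neighbours_below\<close>). Thus each predecessor of \<open>v\<close> is a predecessor of \<open>s\<close>, or is
  \<open>s\<close>, or is \<open><\<close>-below \<open>v\<close>. By wellfounded induction along \<open>\<prec>\<close> the predecessors of \<open>s\<close> have a
  \<open><\<close>-bound \<open>b\<close>, and then the maximum of \<open>b\<close>, \<open>s\<close> and \<open>v\<close> bounds those of \<open>v\<close>.

  If a set is not \<open>\<prec>\<close>-cofinal, then all its elements are \<open>\<prec>\<close>-before some vertex, hence it is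
  \<open><\<close>-bounded. Since the order type is a limit, there is a vertex above the bound, and the set
  is not \<open><\<close>-cofinal.
\<close>

context wellordered_connected_graph
begin

abbreviation "stages \<equiv> ordinals_for V"
abbreviation "stage \<equiv> search_stage stages V E r"
abbreviation "entry \<equiv> entry_stage V E r"
abbreviation "earlier \<equiv> traversal V E r"

lemma stages_wo: "wo_rel stages"
  unfolding wo_rel_def
  by (rule card_order_on_well_order_on[OF cardSuc_Card_order[OF card_of_Card_order]])

lemma entry_in:
  assumes "v \<in> V"
  shows "entry v \<in> Field stages" "v \<in> stage (entry v)"
proof -
  let ?A = "{\<alpha> \<in> Field stages. v \<in> stage \<alpha>}"
  have "wo_rel.minim stages ?A \<in> ?A"
    using all_vertices_enter[OF assms] by (intro wo_rel.minim_in[OF stages_wo]) auto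
  then show "entry v \<in> Field stages" "v \<in> stage (entry v)"
    by (auto simp: entry_stage_def)
qed

lemma in_stage_iff_entry_le:
  assumes "v \<in> V" "\<alpha> \<in> Field stages"
  shows "v \<in> stage \<alpha> \<longleftrightarrow> (entry v, \<alpha>) \<in> stages"
proof
  assume "v \<in> stage \<alpha>"
  then have "\<alpha> \<in> {\<alpha> \<in> Field stages. v \<in> stage \<alpha>}"
    using assms(2) by simp
  then show "(entry v, \<alpha>) \<in> stages"
    unfolding entry_stage_def by (intro wo_rel.minim_least[OF stages_wo]) blast+
next
  assume "(entry v, \<alpha>) \<in> stages"
  then show "v \<in> stage \<alpha>"
    by (rule subsetD[OF search_stage_mono[OF stages_wo] entry_in(2)[OF assms(1)]])
qed

text \<open>
  Limit stages only collect what is already there, so a vertex enters at a successor stage, as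
  the one vertex that the step from \<open>\<beta>\<close> to its successor selects.
\<close>

lemma entry_step:
  assumes v: "v \<in> V"
  obtains \<beta> where "\<beta> \<in> Field stages" "aboveS stages \<beta> \<noteq> {}"
    "entry v = wo_rel.succ stages \<beta>" "v \<notin> stage \<beta>"
    "v = wo_rel.minim r (if \<beta> = wo_rel.zero stages then V else frontier V E (stage \<beta>))"
    "\<beta> \<noteq> wo_rel.zero stages \<Longrightarrow> v \<in> frontier V E (stage \<beta>)"
proof -
  note k = stages_wo
  have "wo_rel.isSucc stages (entry v)"
  proof (rule ccontr)
    assume "\<not> ?thesis"
    then have lim: "wo_rel.isLim stages (entry v)" by (simp add: wo_rel.isLim_def[OF k])
    have "entry v \<noteq> wo_rel.zero stages"
    proof
      assume zero: "entry v = wo_rel.zero stages"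
      show False using entry_in(2)[OF v] unfolding zero search_stage_zero[OF k] by simp
    qed
    from search_stage_limit[OF k lim this, of V E r] entry_in(2)[OF v]
    have "v \<in> (\<Union>\<beta>\<in>underS stages (entry v). stage \<beta>)" by (rule subst)
    then obtain \<beta> where \<beta>: "\<beta> \<in> underS stages (entry v)" "v \<in> stage \<beta>" by (rule UN_E)
    have lt: "(\<beta>, entry v) \<in> stages" "\<beta> \<noteq> entry v" using \<beta>(1) by (auto simp: underS_def)
    have "(entry v, \<beta>) \<in> stages"
      using in_stage_iff_entry_le[OF v FieldI1[OF lt(1)]] \<beta>(2) by simp
    then have "\<beta> = entry v" by (rule antisymD[OF wo_rel.ANTISYM[OF k] lt(1)])
    with lt(2) show False ..
  qed
  then obtain \<beta> where \<beta>: "aboveS stages \<beta> \<noteq> {}" "entry v = wo_rel.succ stages \<beta>"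
    by (auto simp: wo_rel.isSucc_def[OF k])
  have F: "\<beta> \<in> Field stages" using \<beta>(1) unfolding aboveS_def by (blast intro: FieldI1)
  have out: "v \<notin> stage \<beta>"
    using in_stage_iff_entry_le[OF v F] wo_rel.succ_not_in[OF k \<beta>(1)] \<beta>(2) by simp
  have new: "v \<in> (if \<beta> = wo_rel.zero stages then {wo_rel.minim r V}
      else search_step V E r (stage \<beta>))"
    using entry_in(2)[OF v] unfolding \<beta>(2) search_stage_succ[OF k \<beta>(1)] .
  have sel: "frontier V E (stage \<beta>) \<noteq> {}" "v = wo_rel.minim r (frontier V E (stage \<beta>))"
    if "\<beta> \<noteq> wo_rel.zero stages"
  proof -
    have "v \<in> search_step V E r (stage \<beta>)" using new unfolding if_not_P[OF that] .
    then show "frontier V E (stage \<beta>) \<noteq> {}" "v = wo_rel.minim r (frontier V E (stage \<beta>))"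
      using out unfolding search_step_def by (metis insertE)+
  qed
  show thesis
  proof (rule that[OF F \<beta> out])
    show "v = wo_rel.minim r (if \<beta> = wo_rel.zero stages then V else frontier V E (stage \<beta>))"
    proof (cases "\<beta> = wo_rel.zero stages")
      case True
      show ?thesis using new unfolding if_P[OF True] by (rule singletonD)
    next
      case False
      show ?thesis unfolding if_not_P[OF False] by (rule sel(2)[OF False])
    qed
    show "v \<in> frontier V E (stage \<beta>)" if "\<beta> \<noteq> wo_rel.zero stages"
      using minim_frontier[OF sel(1)[OF that]] unfolding sel(2)[OF that, symmetric] .
  qed
qed

lemma earlier_iff_in_stage:
  assumes "v \<in> V" "\<beta> \<in> Field stages" "aboveS stages \<beta> \<noteq> {}"
    and "entry v = wo_rel.succ stages \<beta>"
  shows "(u, v) \<in> earlier \<longleftrightarrow> u \<in> stage \<beta>"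
proof (cases "u \<in> V")
  case True
  have "(entry u, wo_rel.succ stages \<beta>) \<in> stages - Id \<longleftrightarrow> (entry u, \<beta>) \<in> stages"
    using wo_rel.less_succ[OF stages_wo assms(3)] wo_rel.succ_not_in[OF stages_wo assms(3)]
    by auto
  then show ?thesis
    using True assms(1,4) in_stage_iff_entry_le[OF True assms(2)] by (simp add: traversal_def)
next
  case False
  then show ?thesis using search_stage_subset[OF stages_wo] by (auto simp: traversal_def)
qed

lemma wf_earlier: "wf earlier"
proof (rule wf_subset)
  show "wf (inv_image (stages - Id) entry)"
    by (intro wf_inv_image wo_rel.WF stages_wo)
  show "earlier \<subseteq> inv_image (stages - Id) entry"
    by (auto simp: traversal_def)
qed

text \<open>
  Different vertices enter at different stages, because a step selects just one vertex.
\<close>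

lemma earlier_total:
  assumes u: "u \<in> V" and v: "v \<in> V" and "u \<noteq> v"
  shows "(u, v) \<in> earlier \<or> (v, u) \<in> earlier"
proof -
  have "entry u \<noteq> entry v"
  proof
    assume eq: "entry u = entry v"
    obtain \<beta> where \<beta>: "aboveS stages \<beta> \<noteq> {}" "entry u = wo_rel.succ stages \<beta>"
      "u = wo_rel.minim r (if \<beta> = wo_rel.zero stages then V else frontier V E (stage \<beta>))"
      by (rule entry_step[OF u])
    obtain \<gamma> where \<gamma>: "aboveS stages \<gamma> \<noteq> {}" "entry v = wo_rel.succ stages \<gamma>"
      "v = wo_rel.minim r (if \<gamma> = wo_rel.zero stages then V else frontier V E (stage \<gamma>))"
      by (rule entry_step[OF v])
    have "\<beta> = \<gamma>" using wo_rel.succ_inj[OF stages_wo \<beta>(1) \<gamma>(1)] \<beta>(2) \<gamma>(2) eq by simp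
    then have "u = v" by (subst \<beta>(3), subst \<gamma>(3)) (simp only:)
    with \<open>u \<noteq> v\<close> show False ..
  qed
  moreover have "(entry u, entry v) \<in> stages \<or> (entry v, entry u) \<in> stages"
    using wo_rel.TOTALS[OF stages_wo, rule_format, OF entry_in(1)[OF u] entry_in(1)[OF v]] .
  ultimately show ?thesis using u v by (auto simp: traversal_def)
qed

text \<open>
  The hypothesis says that \<open>v\<close> is not the root. All other vertices are selected from a frontier.
\<close>

lemma earlier_neighbour:
  assumes "(u, v) \<in> earlier"
  obtains s where "(s, v) \<in> earlier" "(s, v) \<in> E"
proof -
  have v: "v \<in> V" using assms by (simp add: traversal_def)
  obtain \<beta> where \<beta>: "\<beta> \<in> Field stages" "aboveS stages \<beta> \<noteq> {}"
    "entry v = wo_rel.succ stages \<beta>"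
    and front: "\<beta> \<noteq> wo_rel.zero stages \<longrightarrow> v \<in> frontier V E (stage \<beta>)"
    using entry_step[OF v, of ?thesis] by blast
  note before = earlier_iff_in_stage[OF v \<beta>(1-3)]
  have "\<beta> \<noteq> wo_rel.zero stages"
    using assms before search_stage_zero[OF stages_wo, of V E r] by auto
  then obtain s where "s \<in> stage \<beta>" "(s, v) \<in> E"
    using front by (auto simp: frontier_def)
  then show thesis using that before by blast
qed

text \<open>
  At the step that selects \<open>u\<close>, the vertex \<open>v\<close> is on the frontier because of its neighbour \<open>s\<close>,
  and the search selects the \<open><\<close>-least vertex of the frontier.
\<close>

lemma between_neighbours_below:
  assumes su: "(s, u) \<in> earlier" and uv: "(u, v) \<in> earlier" and "(s, v) \<in> E"
  shows "(u, v) \<in> r"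
proof -
  have u: "u \<in> V" and v: "v \<in> V" using uv by (simp_all add: traversal_def)
  obtain \<beta> where \<beta>: "\<beta> \<in> Field stages" "aboveS stages \<beta> \<noteq> {}"
    "entry u = wo_rel.succ stages \<beta>"
    "u = wo_rel.minim r (if \<beta> = wo_rel.zero stages then V else frontier V E (stage \<beta>))"
    by (rule entry_step[OF u])
  have s: "s \<in> stage \<beta>" using su earlier_iff_in_stage[OF u \<beta>(1-3)] by blast
  then have nz: "\<beta> \<noteq> wo_rel.zero stages"
    using search_stage_zero[OF stages_wo, of V E r] by auto
  have "v \<notin> stage \<beta>"
  proof
    assume "v \<in> stage \<beta>"
    then have "(v, u) \<in> earlier" using earlier_iff_in_stage[OF u \<beta>(1-3)] by blast
    then show False using uv wf_not_sym[OF wf_earlier] by blast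
  qed
  then have "v \<in> frontier V E (stage \<beta>)"
    using s v \<open>(s, v) \<in> E\<close> by (auto simp: frontier_def)
  moreover have "frontier V E (stage \<beta>) \<subseteq> Field r"
    using r_Field by (auto simp: frontier_def)
  ultimately have "(wo_rel.minim r (frontier V E (stage \<beta>)), v) \<in> r"
    using wo_rel.minim_least[OF r_wo] by blast
  then show ?thesis using \<beta>(4) nz by simp
qed

lemma upper_bound_of_two:
  assumes "x \<in> V" "y \<in> V"
  obtains z where "z \<in> V" "(x, z) \<in> r" "(y, z) \<in> r"
proof -
  have "(x, x) \<in> r" "(y, y) \<in> r" "(x, y) \<in> r \<or> (y, x) \<in> r"
    using assms wo_rel.TOTALS[OF r_wo, unfolded r_Field] by blast+
  then show thesis using that[OF assms(1)] that[OF assms(2)] by blast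
qed

lemma predecessors_bounded:
  assumes "v \<in> V"
  shows "\<exists>b\<in>V. \<forall>u. (u, v) \<in> earlier \<longrightarrow> (u, b) \<in> r"
  using assms
proof (induction v rule: wf_induct_rule[OF wf_earlier])
  case (1 v)
  show ?case
  proof (cases "\<exists>u. (u, v) \<in> earlier")
    case True
    then obtain u where "(u, v) \<in> earlier" ..
    then obtain s where s: "(s, v) \<in> earlier" "(s, v) \<in> E"
      by (rule earlier_neighbour)
    then have "s \<in> V" by (simp add: traversal_def)
    then obtain b where b: "b \<in> V" "\<And>u. (u, s) \<in> earlier \<Longrightarrow> (u, b) \<in> r"
      using 1(1)[OF s(1)] by blast
    obtain c where c: "c \<in> V" "(b, c) \<in> r" "(s, c) \<in> r"
      using upper_bound_of_two[OF b(1) \<open>s \<in> V\<close>] .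
    obtain d where d: "d \<in> V" "(c, d) \<in> r" "(v, d) \<in> r"
      using upper_bound_of_two[OF c(1) 1(2)] .
    have "(u, d) \<in> r" if u: "(u, v) \<in> earlier" for u
    proof -
      have "u \<in> V" using u by (simp add: traversal_def)
      then consider "(u, s) \<in> earlier" | "u = s" | "(s, u) \<in> earlier"
        using earlier_total \<open>s \<in> V\<close> by blast
      then show ?thesis
      proof cases
        case 1
        then have "(u, c) \<in> r" by (rule transD[OF wo_rel.TRANS[OF r_wo] b(2) c(2)])
        then show ?thesis by (rule transD[OF wo_rel.TRANS[OF r_wo] _ d(2)])
      next
        case 2
        then show ?thesis using transD[OF wo_rel.TRANS[OF r_wo] c(3) d(2)] by simp
      next
        case 3
        then have "(u, v) \<in> r" by (rule between_neighbours_below[OF _ u s(2)])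
        then show ?thesis by (rule transD[OF wo_rel.TRANS[OF r_wo] _ d(3)])
      qed
    qed
    then show ?thesis using d(1) by blast
  next
    case False
    then show ?thesis using 1(2) by blast
  qed
qed

end

theorem theorem3p2:
  fixes V :: "'v set" and E :: "'v rel" and r :: "'v rel" and A :: "'v set"
  assumes "wellordered_connected_graph V E r"
    and "isLimOrd r"
    and "cofinal_subset V r A"
  shows "cofinal_subset V (traversal V E r) A"
proof -
  interpret wellordered_connected_graph V E r by fact
  have A: "A \<subseteq> V" and cof: "\<And>v. v \<in> V \<Longrightarrow> \<exists>a\<in>A. (v, a) \<in> r\<^sup>="
    using assms(3) by (auto simp: cofinal_subset_def)
  have "\<exists>a\<in>A. (v, a) \<in> earlier\<^sup>=" if v: "v \<in> V" for v
  proof (rule ccontr)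
    assume "\<not> ?thesis"
    then have all_earlier: "(a, v) \<in> earlier" if "a \<in> A" for a
      using that A v earlier_total[of a v] by blast
    obtain b where b: "b \<in> V" "\<And>u. (u, v) \<in> earlier \<Longrightarrow> (u, b) \<in> r"
      using predecessors_bounded[OF v] by blast
    have "aboveS r b \<noteq> {}"
      using wo_rel.isLimOrd_aboveS[OF r_wo assms(2)] b(1) r_Field by blast
    then obtain c where c: "(b, c) \<in> r" "c \<noteq> b" by (auto simp: aboveS_def)
    then have "c \<in> V" using r_Field by (auto intro: FieldI2)
    then obtain a where a: "a \<in> A" "(c, a) \<in> r\<^sup>=" using cof by blast
    have "(a, b) \<in> r" using b(2) all_earlier[OF a(1)] .
    then have "(c, b) \<in> r"
      using a(2) transD[OF wo_rel.TRANS[OF r_wo], of c a b] by blast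
    then show False using c antisymD[OF wo_rel.ANTISYM[OF r_wo], of b c] by blast
  qed
  then show ?thesis using A by (simp add: cofinal_subset_def)
qed

end
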